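(* Let $s\in(0,\tfrac18)$, $a=1-\sqrt{2s}\in(\tfrac12,1)$ and $\bar r(a)=\frac{1-2a+\sqrt{4a^2-4a+9}}{4}$. The consumer surplus at the equilibrium prices strictly increases as the firms' return cost $r$ increases over $r\in[0,\bar r(a)]$.
   Context: Two firms sell one product each at zero marginal cost. Consumers (unit mass) have match values $u_1,u_2$, i.i.d. uniform on $[0,1]$. Firm 1 is prominent (searched and bought first, at no search cost); searching and buying product 2 costs $s\in(0,1/8)$; returned units are fully refunded and cost the firm $r$ each. Prices are not observed before search, so search decisions depend on the actual $p_1$ and the expected (equilibrium) price $p_2$: with $a=1-\sqrt{2s}$, a consumer buys product 2 iff $u_1<A:=a+p_1-p_2$; a consumer who does so keeps the product with the larger $u_i-p_i$ if this is nonnegative and returns the rest, while a consumer with $u_1\ge A$ keeps product 1. Given a candidate pair $(p_1,p_2)$, the deviation profits are as follows. If Firm 1 charges $p$ instead of $p_1$, $$\pi_1(p)=(p+r)\Big[1-(a+p-p_2)+\tfrac12(a^2-p_2^2)\Big]-r .$$ If Firm 2 charges $p$ instead of $p_2$ (consumers still expect $p_2$ when deciding whether to search), $$\pi_2(p)=(p+r)\Big[(a+p_1-p_2)\big(1-(a+p-p_2)\big)+\tfrac12(a-p_2)(a-p_2+2p_1)\Big]-r(a+p_1-p_2).$$ A pair $(p_1,p_2)$ of nonnegative prices is an equilibrium if $p_1$ maximizes $\pi_1(\cdot)$ over $p\ge0$ and $p_2$ maximizes $\pi_2(\cdot)$ over $p\ge 0$. For each $r\in[0,1]$ the paper shows there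 is exactly one equilibrium with $p_1,p_2\in[0,\frac{1-r}{2}]$; this is "the" equilibrium. Consumer surplus at prices $(p_1,p_2)$ is the expected net utility minus search costs: $$CS(p_1,p_2)=\mathbb E\big[(u_1-p_1)\mathbf 1\{u_1\ge A\}\big]+\mathbb E\big[\max\{0,u_1-p_1,u_2-p_2\}\mathbf 1\{u_1<A\}\big]-s\,\Pr\{u_1<A\},\quad A=a+p_1-p_2.$$ *)

theory Defs
  imports "HOL-Analysis.Analysis"
begin

definition search_threshold :: "real \<Rightarrow> real" where
  "search_threshold s = 1 - sqrt (2 * s)"

text \<open>
  In the profits below, \<open>p1\<close> and \<open>p2\<close> are the candidate (expected) prices, \<open>a\<close> is the
  search threshold, \<open>r\<close> is the return cost per unit, and the last argument \<open>p\<close> is the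
  price actually charged by the deviating firm.
  The profit of each firm is \<open>p\<close> times the units kept minus \<open>r\<close> times the units returned.
  Everybody buys product 1, and the bracket in \<open>profit1\<close> is the mass keeping it: those who do
  not search, plus those who search and still prefer it. The mass \<open>a + p1 - p2\<close> buys product 2,
  and the bracket in \<open>profit2\<close> is the mass keeping it.
\<close>

definition profit1 :: "real \<Rightarrow> real \<Rightarrow> real \<Rightarrow> real \<Rightarrow> real" where
  "profit1 a r p2 p = (p + r) * (1 - (a + p - p2) + 1/2 * (a\<^sup>2 - p2\<^sup>2)) - r"

definition profit2 :: "real \<Rightarrow> real \<Rightarrow> real \<Rightarrow> real \<Rightarrow> real \<Rightarrow> real" where
  "profit2 a r p1 p2 p =
     (p + r) * ((a + p1 - p2) * (1 - (a + p - p2)) + 1/2 * (a - p2) * (a - p2 + 2 * p1))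
     - r * (a + p1 - p2)"

text \<open>\<open>is_arg_max\<close> also requires \<open>p1\<close> and \<open>p2\<close> themselves to be nonnegative.\<close>

definition equilibrium :: "real \<Rightarrow> real \<Rightarrow> real \<Rightarrow> real \<Rightarrow> bool" where
  "equilibrium a r p1 p2 \<longleftrightarrow>
     is_arg_max (profit1 a r p2) (\<lambda>p. 0 \<le> p) p1 \<and>
     is_arg_max (profit2 a r p1 p2) (\<lambda>p. 0 \<le> p) p2"

text \<open>
  For the parameters considered there is exactly one equilibrium with both prices in
  \<open>[0, (1 - r) / 2]\<close>; this is the one selected.
\<close>

definition equilibrium_prices :: "real \<Rightarrow> real \<Rightarrow> real \<times> real" where
  "equilibrium_prices a r =
     (THE (p1, p2). equilibrium a r p1 p2 \<and> p1 \<in> {0..(1 - r) / 2} \<and> p2 \<in> {0..(1 - r) / 2})"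

text \<open>Joint law of the match values: two independent uniform variables on \<open>[0, 1]\<close>.\<close>

definition match_values :: "(real \<times> real) measure" where
  "match_values = uniform_measure lborel {0..1} \<Otimes>\<^sub>M uniform_measure lborel {0..1}"

definition consumer_surplus :: "real \<Rightarrow> real \<Rightarrow> real \<Rightarrow> real" where
  "consumer_surplus s p1 p2 =
     (let A = search_threshold s + p1 - p2 in
        (LINT (u1, u2)|match_values. (u1 - p1) * indicator {A..} u1)
      + (LINT (u1, u2)|match_values. Max {0, u1 - p1, u2 - p2} * indicator {..<A} u1)
      - s * measure match_values {(u1, u2) \<in> space match_values. u1 < A})"

definition rbar :: "real \<Rightarrow> real" where
  "rbar a = (1 - 2 * a + sqrt (4 * a\<^sup>2 - 4 * a + 9)) / 4"

end

theory Submission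
  imports Defs "HOL-Probability.Probability_Measure"
begin

text \<open>
  Substituting firm 1's best response into firm 2's first-order condition leaves one equation
  \<open>excess a r y = 0\<close> for \<open>p2 = y\<close>. Its left-hand side is strictly increasing in \<open>y\<close>, because both
  best responses have slope at most \<open>1/2\<close> in the other price, and strictly increasing in \<open>r\<close>.
  Hence the equilibrium is unique, \<open>p2\<close> strictly decreases in \<open>r\<close>, and \<open>p1\<close> weakly decreases;
  \<open>p1\<close> may be at the corner \<open>0\<close> for large \<open>r\<close>, but \<open>r \<le> rbar a < 1 - a / 2\<close> keeps \<open>p2\<close> interior.
  Moreover \<open>p1 \<le> p2\<close>, so the search cut-off lies in \<open>[0, 1]\<close> and the consumer surplus is a cubic
  polynomial in the prices, decreasing in both.
\<close>

section \<open>Integration over the match values and the closed form of the consumer surplus\<close>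

lemma integral_uniform_unit_interval:
  fixes f :: "real \<Rightarrow> real"
  assumes "f \<in> borel_measurable borel"
  shows "(LINT x|uniform_measure lborel {0..1}. f x) = (LINT x|lborel. f x * indicator {0..1} x)"
proof -
  have "uniform_measure lborel {0..1} = density lborel (\<lambda>x::real. ennreal (indicator {0..1} x))"
    unfolding uniform_measure_def
    by (rule arg_cong[of _ _ "density lborel"]) (auto simp: fun_eq_iff indicator_def)
  then show ?thesis
    using assms by (simp add: integral_density mult.commute)
qed

text \<open>Fubini: a bound on the unit square, which carries all the mass, already gives
  integrability.\<close>

lemma integral_match_values:
  fixes f :: "real \<Rightarrow> real \<Rightarrow> real"
  assumes f: "case_prod f \<in> borel_measurable (borel \<Otimes>\<^sub>M borel)"
    and bound: "\<And>x y. \<lbrakk>x \<in> {0..1}; y \<in> {0..1}\<rbrakk> \<Longrightarrow> \<bar>f x y\<bar> \<le> B"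
  shows "(LINT (x, y)|match_values. f x y)
    = (LINT x|lborel. (LINT y|lborel. f x y * indicator {0..1} y) * indicator {0..1} x)"
proof -
  let ?U = "uniform_measure lborel {0..1::real}"
  interpret U: prob_space ?U
    by (rule prob_space_uniform_measure) auto
  interpret P: pair_prob_space ?U ?U ..
  note f [measurable]
  have AEU: "AE x in ?U. x \<in> {0..1}"
    by (rule AE_uniform_measureI) auto
  have "AE z in ?U \<Otimes>\<^sub>M ?U. norm (case_prod f z) \<le> B"
  proof (rule P.AE_pair_measure)
    show "{z \<in> space (?U \<Otimes>\<^sub>M ?U). norm (case_prod f z) \<le> B} \<in> sets (?U \<Otimes>\<^sub>M ?U)"
      by measurable
    show "AE x in ?U. AE y in ?U. norm (case_prod f (x, y)) \<le> B"
      using AEU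
    proof eventually_elim
      case (elim x)
      show ?case using AEU
        by eventually_elim (use elim bound in auto)
    qed
  qed
  then have "integrable (?U \<Otimes>\<^sub>M ?U) (case_prod f)"
    by (rule P.integrable_const_bound) measurable
  then have "(LINT (x, y)|match_values. f x y) = (LINT x|?U. LINT y|?U. f x y)"
    unfolding match_values_def using P.integral_fst' by fastforce
  also have "\<dots> = (LINT x|?U. LINT y|lborel. f x y * indicator {0..1} y)"
    by (intro Bochner_Integration.integral_cong refl integral_uniform_unit_interval) measurable
  also have "\<dots> = (LINT x|lborel. (LINT y|lborel. f x y * indicator {0..1} y) * indicator {0..1} x)"
    by (rule integral_uniform_unit_interval) measurable
  finally show ?thesis .
qed

lemma integral_below_FTC:
  fixes f F :: "real \<Rightarrow> real"
  assumes "0 \<le> A" "A \<le> 1" and "\<And>x. DERIV F x :> f x" and "\<And>x. isCont f x"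
  shows "(LINT x|lborel. f x * indicator {..<A} x * indicator {0..1} x) = F A - F 0"
proof -
  have [measurable]: "f \<in> borel_measurable borel"
    using assms(4) by (simp add: borel_measurable_continuous_onI continuous_at_imp_continuous_on)
  have "(LINT x|lborel. f x * indicator {..<A} x * indicator {0..1} x)
      = (LINT x|lborel. f x * indicator {0..A} x)"
  proof (rule integral_cong_AE)
    show "AE x in lborel. f x * indicator {..<A} x * indicator {0..1} x = f x * indicator {0..A} x"
      using AE_lborel_singleton[of A]
      by eventually_elim (use assms(2) in \<open>auto simp: indicator_def\<close>)
  qed measurable
  also have "\<dots> = F A - F 0"
    by (rule integral_FTC_Icc_real) (use assms in auto)
  finally show ?thesis .
qed

lemma integral_above_FTC:
  fixes f F :: "real \<Rightarrow> real"
  assumes "0 \<le> A" "A \<le> 1" and "\<And>x. DERIV F x :> f x" and "\<And>x. isCont f x"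
  shows "(LINT x|lborel. f x * indicator {A..} x * indicator {0..1} x) = F 1 - F A"
proof -
  have "(LINT x|lborel. f x * indicator {A..} x * indicator {0..1} x)
      = (LINT x|lborel. f x * indicator {A..1} x)"
    by (rule Bochner_Integration.integral_cong) (use assms in \<open>auto simp: indicator_def\<close>)
  also have "\<dots> = F 1 - F A"
    by (rule integral_FTC_Icc_real) (use assms in auto)
  finally show ?thesis .
qed

text \<open>Powers from 2 on smooth out the kink at \<open>c\<close>, so integrands with positive
  parts have antiderivatives on the whole line and no integral needs splitting.\<close>

lemma DERIV_max_zero_power:
  assumes "n \<ge> 1"
  shows "DERIV (\<lambda>x::real. (max 0 (x - c)) ^ Suc n) x :> real (Suc n) * (max 0 (x - c)) ^ n"
proof (cases x c rule: linorder_cases)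
  case less
  have "DERIV (\<lambda>x::real. 0) x :> real (Suc n) * (max 0 (x - c)) ^ n"
    using less assms by (auto intro!: derivative_eq_intros simp: max_def)
  then show ?thesis
    by (rule DERIV_cong_ev[THEN iffD1, rotated -1])
      (use eventually_nhds_in_open[of "{..<c}" x] less in \<open>auto simp: max_def elim!: eventually_mono\<close>)
next
  case greater
  have "DERIV (\<lambda>x::real. (x - c) ^ Suc n) x :> real (Suc n) * (max 0 (x - c)) ^ n"
    using greater by (auto intro!: derivative_eq_intros simp: max_def simp del: power_Suc)
  then show ?thesis
    by (rule DERIV_cong_ev[THEN iffD1, rotated -1])
      (use eventually_nhds_in_open[of "{c<..}" x] greater in \<open>auto simp: max_def elim!: eventually_mono\<close>)
next
  case equal
  \<comment> \<open>This is the difference quotient at the kink; its first factor tends to 0 because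
    \<open>n \<ge> 1\<close>.\<close>
  have "((\<lambda>y::real. max 0 (y - c) ^ n * (if y < c then 0 else 1)) \<longlongrightarrow> 0) (at c)"
  proof (rule tendsto_rabs_zero_cancel, rule tendsto_sandwich[OF _ _ tendsto_const])
    have "((\<lambda>y. max 0 (y - c)) \<longlongrightarrow> max 0 (c - c)) (at c)"
      by (intro tendsto_intros)
    then show "((\<lambda>y::real. max 0 (y - c) ^ n) \<longlongrightarrow> 0) (at c)"
      using assms by simp
  qed auto
  moreover have "(max 0 (y - c) ^ Suc n - max 0 (c - c) ^ Suc n) / (y - c)
      = max 0 (y - c) ^ n * (if y < c then 0 else 1)" if "y \<noteq> c" for y :: real
    using that by (auto simp: max_def)
  ultimately have "DERIV (\<lambda>x::real. (max 0 (x - c)) ^ Suc n) c :> 0"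
    unfolding has_field_derivative_iff
    by (subst tendsto_cong[where g = "\<lambda>y. max 0 (y - c) ^ n * (if y < c then 0 else 1)"])
      (auto simp: eventually_at_filter)
  then show ?thesis using equal assms by (simp add: power_0_left)
qed

text \<open>\<open>v\<close> is the value of the best option in hand, \<open>y - p\<close> that of
  product 2. Their maximum is \<open>v\<close> plus the positive part of
  \<open>y - (p + v)\<close>.\<close>

lemma integral_max_option:
  fixes v p :: real
  assumes "0 \<le> v" "0 \<le> p" "v + p \<le> 1"
  shows "(LINT y|lborel. max v (y - p) * indicator {0..1} y) = v + (1 - p - v)\<^sup>2 / 2"
proof -
  have "(LINT y|lborel. (v + max 0 (y - (p + v))) * indicator {0..1} y)
    = (v * 1 + (max 0 (1 - (p + v)))\<^sup>2 / 2) - (v * 0 + (max 0 (0 - (p + v)))\<^sup>2 / 2)"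
  proof (rule integral_FTC_Icc_real)
    fix x :: real
    define q where "q x = (max 0 (x - (p + v)))\<^sup>2" for x
    have "DERIV q x :> 2 * max 0 (x - (p + v))"
      using DERIV_max_zero_power[of 1 "p + v" x] by (simp add: q_def[abs_def] numeral_2_eq_2)
    then show "DERIV (\<lambda>x. v * x + (max 0 (x - (p + v)))\<^sup>2 / 2) x :> v + max 0 (x - (p + v))"
      unfolding q_def[symmetric] by (auto intro!: derivative_eq_intros)
  qed (auto intro!: continuous_intros)
  also have "(\<lambda>y. (v + max 0 (y - (p + v))) * indicator {0..1} y) = (\<lambda>y. max v (y - p) * indicator {0..1} y)"
    by (auto simp: max_def fun_eq_iff)
  finally show ?thesis using assms by (simp add: diff_diff_eq)
qed

text \<open>The last two hypotheses place the cut-off in \<open>[p1, 1]\<close>, so the positive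
  parts resolve and all three terms become polynomials.\<close>

lemma consumer_surplus_eq:
  fixes s p1 p2 :: real
  defines "a \<equiv> search_threshold s"
  assumes "0 < s" "0 \<le> p1" "0 \<le> p2" "p2 \<le> a" "a + p1 - p2 \<le> 1"
  shows "consumer_surplus s p1 p2 =
    (1 - p1)\<^sup>2 / 2 + p1 * (1 - p2)\<^sup>2 / 2 + ((1 - p2) ^ 3 - (1 - a) ^ 3) / 6
    - (1 - a)\<^sup>2 / 2 * (a + p1 - p2)"
proof -
  define A where "A = a + p1 - p2"
  have A: "0 \<le> A" "A \<le> 1" "p1 \<le> A" using assms by (auto simp: A_def)
  have s: "s = (1 - a)\<^sup>2 / 2" using \<open>0 < s\<close> by (simp add: a_def search_threshold_def)
  have a1: "a \<le> 1" using \<open>0 < s\<close> by (simp add: a_def search_threshold_def)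
  have I1: "(LINT (u1, u2)|match_values. (u1 - p1) * indicator {A..} u1)
      = ((1 - p1)\<^sup>2 - (A - p1)\<^sup>2) / 2"
  proof -
    have "(LINT (u1, u2::real)|match_values. (u1 - p1) * indicator {A..} u1)
      = (LINT x|lborel. (LINT y|lborel. (x - p1) * indicator {A..} x * indicator {0..1::real} y) * indicator {0..1} x)"
      by (rule integral_match_values[of _ "1 + p1"]) (use \<open>0 \<le> p1\<close> in \<open>auto simp: indicator_def abs_if\<close>)
    also have "\<dots> = (LINT x|lborel. (x - p1) * indicator {A..} x * indicator {0..1} x)"
      by simp
    also have "\<dots> = (1 - p1)\<^sup>2 / 2 - (A - p1)\<^sup>2 / 2"
      by (rule integral_above_FTC[OF A(1,2)]) (auto intro!: derivative_eq_intros continuous_intros)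
    finally show ?thesis by (simp add: diff_divide_distrib)
  qed
  have I3: "measure match_values {(u1, u2) \<in> space match_values. u1 < A} = A"
  proof -
    have "measure match_values {(u1, u2) \<in> space match_values. u1 < A}
        = (LINT z|match_values. indicator {(u1, u2). u1 < A} z)"
      by (simp add: Int_def case_prod_unfold conj_commute)
    also have "\<dots> = (LINT (u1, u2::real)|match_values. indicator {..<A} u1)"
      by (rule Bochner_Integration.integral_cong) (auto simp: indicator_def)
    also have "\<dots> = (LINT x|lborel. (LINT y|lborel. indicator {..<A} x * indicator {0..1::real} y) * indicator {0..1} x)"
      by (rule integral_match_values[of _ "1"]) (auto simp: indicator_def)
    also have "\<dots> = (LINT x|lborel. 1 * indicator {..<A} x * indicator {0..1} x)"
      by simp
    also have "\<dots> = A - 0"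
      by (rule integral_below_FTC[OF A(1,2)]) (auto intro!: derivative_eq_intros continuous_intros)
    finally show ?thesis by simp
  qed
  \<comment> \<open>Antiderivative in \<open>u1\<close> of a searcher's expected payoff
    \<open>m + (1 - p2 - m)\<^sup>2 / 2\<close>, expanded in powers of
    \<open>m = max 0 (u1 - p1)\<close>.\<close>
  define F where "F x = (max 0 (x - p1))\<^sup>2 / 2 + (1 - p2)\<^sup>2 / 2 * x - (1 - p2) * ((max 0 (x - p1))\<^sup>2 / 2)
    + (max 0 (x - p1)) ^ 3 / 6" for x
  have I2: "(LINT (u1, u2)|match_values. Max {0, u1 - p1, u2 - p2} * indicator {..<A} u1) = F A - F 0"
  proof -
    have "(LINT (u1, u2)|match_values. Max {0, u1 - p1, u2 - p2} * indicator {..<A} u1)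
       = (LINT (u1, u2)|match_values. max (max 0 (u1 - p1)) (u2 - p2) * indicator {..<A} u1)"
      by (simp add: max.assoc)
    also have "\<dots> = (LINT x|lborel. (LINT y|lborel. max (max 0 (x - p1)) (y - p2) * indicator {..<A} x
        * indicator {0..1} y) * indicator {0..1} x)"
      by (rule integral_match_values[of _ "1"])
        (use \<open>0 \<le> p1\<close> \<open>0 \<le> p2\<close> in \<open>auto simp: indicator_def abs_if max_def\<close>)
    also have "\<dots> = (LINT x|lborel. (max 0 (x - p1) + (1 - p2 - max 0 (x - p1))\<^sup>2 / 2)
        * indicator {..<A} x * indicator {0..1} x)"
    proof (rule Bochner_Integration.integral_cong[OF refl])
      fix x :: real
      show "(LINT y|lborel. max (max 0 (x - p1)) (y - p2) * indicator {..<A} x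
        * indicator {0..1} y) * indicator {0..1} x
        = (max 0 (x - p1) + (1 - p2 - max 0 (x - p1))\<^sup>2 / 2) * indicator {..<A} x * indicator {0..1} x"
      proof (cases "x < A")
        case True
        \<comment> \<open>Below the cut-off the option in hand is worth at most
          \<open>a - p2\<close>.\<close>
        then have "max 0 (x - p1) + p2 \<le> 1" using assms a1 by (auto simp: A_def)
        with integral_max_option[of "max 0 (x - p1)" p2] True \<open>0 \<le> p2\<close> show ?thesis by simp
      qed simp
    qed
    also have "\<dots> = F A - F 0"
    proof (rule integral_below_FTC[OF A(1,2)])
      fix x :: real
      show "DERIV F x :> max 0 (x - p1) + (1 - p2 - max 0 (x - p1))\<^sup>2 / 2"
      proof -
        define q where "q n x = (max 0 (x - p1)) ^ n" for n :: nat and x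
        have q: "DERIV (q 2) x :> 2 * max 0 (x - p1)" "DERIV (q 3) x :> 3 * (max 0 (x - p1))\<^sup>2"
          using DERIV_max_zero_power[of 1 p1 x] DERIV_max_zero_power[of 2 p1 x]
          by (simp_all add: q_def[abs_def] numeral_2_eq_2 numeral_3_eq_3)
        show ?thesis
          unfolding F_def[abs_def] q_def[symmetric]
          by (auto intro!: derivative_eq_intros q simp: power2_eq_square field_simps)
      qed
    qed (auto intro!: continuous_intros)
    finally show ?thesis .
  qed
  have "consumer_surplus s p1 p2 = ((1 - p1)\<^sup>2 - (A - p1)\<^sup>2) / 2 + (F A - F 0) - s * A"
    unfolding consumer_surplus_def Let_def a_def[symmetric] A_def[symmetric] I1 I2 I3 ..
  also have "F A - F 0 = (A - p1)\<^sup>2 / 2 + (1 - p2)\<^sup>2 / 2 * A - (1 - p2) * ((A - p1)\<^sup>2 / 2) + (A - p1) ^ 3 / 6"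
    using A \<open>0 \<le> p1\<close> by (simp add: F_def max_def)
  finally show ?thesis
    unfolding s A_def by (simp add: field_simps power2_eq_square power3_eq_cube)
qed

section \<open>Best responses and the equilibrium conditions\<close>

lemma is_arg_max_quadratic:
  fixes c d r K x :: real
  assumes "c > 0"
  shows "is_arg_max (\<lambda>p. c * ((p + r) * (K - p)) + d) (\<lambda>p. 0 \<le> p) x \<longleftrightarrow> x = max 0 ((K - r) / 2)"
proof -
  define m where "m = max 0 ((K - r) / 2)"
  let ?f = "\<lambda>p. c * ((p + r) * (K - p)) + d"
  \<comment> \<open>Quadratic decay away from \<open>m\<close> gives maximality and uniqueness at
    once. The slack is \<open>c * ((p - m) * (2 * m - (K - r)))\<close>: either \<open>m\<close> is
    the vertex, or \<open>m = 0\<close> and both factors are nonnegative.\<close>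
  have gap: "?f p + c * (p - m)\<^sup>2 \<le> ?f m" if "0 \<le> p" for p
  proof -
    have "0 \<le> (p - m) * (2 * m - (K - r))"
    proof (cases "r < K")
      case True
      then have "2 * m - (K - r) = 0" by (simp add: m_def)
      then show ?thesis by simp
    next
      case False
      with that show ?thesis by (simp add: m_def)
    qed
    then have "0 \<le> c * ((p - m) * (2 * m - (K - r)))" using assms by simp
    then show ?thesis by (simp add: algebra_simps power2_eq_square)
  qed
  have m0: "0 \<le> m" by (simp add: m_def)
  have "is_arg_max ?f (\<lambda>p. 0 \<le> p) x \<longleftrightarrow> x = m"
  proof
    assume x: "is_arg_max ?f (\<lambda>p. 0 \<le> p) x"
    then have "?f m \<le> ?f x" "0 \<le> x" using m0 by (auto simp: is_arg_max_linorder)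
    with gap[of x] have "c * (x - m)\<^sup>2 \<le> 0" by linarith
    then show "x = m" using assms by (simp add: mult_le_0_iff)
  next
    assume "x = m"
    moreover have "?f p \<le> ?f m" if "0 \<le> p" for p
    proof -
      have "0 \<le> c * (p - m)\<^sup>2" using assms by simp
      with gap[OF that] show ?thesis by linarith
    qed
    ultimately show "is_arg_max ?f (\<lambda>p. 0 \<le> p) x" using m0 by (simp add: is_arg_max_linorder)
  qed
  then show ?thesis by (simp add: m_def)
qed

definition best_price1 :: "real \<Rightarrow> real \<Rightarrow> real \<Rightarrow> real" where
  "best_price1 a r y = max 0 ((1 - a - r + y + (a\<^sup>2 - y\<^sup>2) / 2) / 2)"

text \<open>The bracket in \<open>profit2\<close> is \<open>(a + x - y) * (1 - a + y - p + kept_share a x y)\<close>.\<close>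

definition kept_share :: "real \<Rightarrow> real \<Rightarrow> real \<Rightarrow> real" where
  "kept_share a x y = ((a - y) + (a - y) * x / (a - y + x)) / 2"

text \<open>Each profit is a concave quadratic in the deviation price, for firm 2 after factoring
  out the mass of buyers. The expected price is held fixed while maximising and equated with the
  maximiser afterwards, which removes the factor 1/2 from firm 2's condition.\<close>

lemma equilibrium_iff:
  assumes "0 \<le> x" "0 \<le> y" "y < a" "r < 1 - a / 2"
  shows "equilibrium a r x y \<longleftrightarrow> x = best_price1 a r y \<and> y = 1 - a - r + kept_share a x y"
proof -
  define t where "t = a - y"
  have t: "0 < t" "0 < t + x" using assms by (auto simp: t_def)
  have A: "a + x - y = t + x" by (simp add: t_def)
  have "profit1 a r y = (\<lambda>p. 1 * ((p + r) * ((1 - a + y + (a\<^sup>2 - y\<^sup>2) / 2) - p)) + (- r))"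
    by (auto simp: profit1_def fun_eq_iff algebra_simps diff_divide_distrib)
  then have 1: "is_arg_max (profit1 a r y) (\<lambda>p. 0 \<le> p) x \<longleftrightarrow> x = best_price1 a r y"
    using is_arg_max_quadratic[of 1 r "1 - a + y + (a\<^sup>2 - y\<^sup>2) / 2" "- r" x]
    by (simp add: best_price1_def algebra_simps)
  have k: "(t + x) * kept_share a x y = 1/2 * t * (t + 2 * x)"
    using t unfolding kept_share_def t_def[symmetric] by (simp add: field_simps)
  have "profit2 a r x y = (\<lambda>p. (t + x) * ((p + r) * ((1 - a + y + kept_share a x y) - p)) + - (r * (t + x)))"
  proof (rule ext)
    fix p
    have "profit2 a r x y p = (p + r) * ((t + x) * (1 - (a + p - y)) + (t + x) * kept_share a x y) - r * (t + x)"
      unfolding profit2_def A k by (simp add: t_def)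
    then show "profit2 a r x y p = (t + x) * ((p + r) * ((1 - a + y + kept_share a x y) - p)) + - (r * (t + x))"
      by (simp add: algebra_simps)
  qed
  then have "is_arg_max (profit2 a r x y) (\<lambda>p. 0 \<le> p) y
      \<longleftrightarrow> y = max 0 ((1 - a + y + kept_share a x y - r) / 2)"
    using is_arg_max_quadratic[OF t(2), of r "1 - a + y + kept_share a x y" "- (r * (t + x))" y]
    by (simp only:)
  also have "\<dots> \<longleftrightarrow> y = 1 - a - r + kept_share a x y"
  proof -
    \<comment> \<open>At \<open>y = 0\<close> this makes the share at least \<open>a / 2\<close>, so
      \<open>r < 1 - a / 2\<close> gives a positive vertex and rules out the corner.\<close>
    have "t / 2 \<le> kept_share a x y"
      using t assms unfolding kept_share_def t_def[symmetric] by simp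
    then show ?thesis
      using assms by (auto simp: max_def t_def)
  qed
  finally show ?thesis unfolding equilibrium_def 1 by simp
qed

section \<open>Monotonicity of the responses in prices and cost\<close>

text \<open>With \<open>t = a - y\<close>, the secant slope of \<open>t * x / (t + x)\<close> in
  \<open>x\<close> is the product of \<open>t / (t + x)\<close> and \<open>t / (t + x')\<close>,
  which lies in \<open>[0, 1]\<close>; the share carries half of it.\<close>

lemma kept_share_mono1:
  assumes "0 \<le> x" "x \<le> x'" "y < a"
  shows "kept_share a x y \<le> kept_share a x' y"
    and "kept_share a x' y \<le> kept_share a x y + (x' - x) / 2"
proof -
  define t where "t = a - y"
  have t: "0 < t" using assms by (simp add: t_def)
  have eq: "kept_share a x' y - kept_share a x y = (x' - x) / 2 * (t / (t + x) * (t / (t + x')))"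
  proof -
    have "t + x \<noteq> 0" "t + x' \<noteq> 0" using t assms by auto
    then have "t * x' / (t + x') - t * x / (t + x) = (x' - x) * (t / (t + x) * (t / (t + x')))"
      by (simp add: divide_simps) (simp add: algebra_simps)
    then show ?thesis unfolding kept_share_def t_def[symmetric] by (simp add: diff_divide_distrib[symmetric])
  qed
  have "t / (t + x) * (t / (t + x')) \<le> 1"
    using t assms by (intro mult_le_one) (auto simp: divide_simps)
  moreover have "0 \<le> t / (t + x) * (t / (t + x'))"
    using t assms by auto
  moreover have "0 \<le> (x' - x) / 2" using assms by simp
  ultimately have "0 \<le> kept_share a x' y - kept_share a x y"
    "kept_share a x' y - kept_share a x y \<le> (x' - x) / 2"
    unfolding eq by (blast intro: mult_nonneg_nonneg mult_left_le)+
  then show "kept_share a x y \<le> kept_share a x' y"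
    "kept_share a x' y \<le> kept_share a x y + (x' - x) / 2"
    by linarith+
qed

lemma kept_share_antimono2:
  assumes "0 \<le> x" "y \<le> y'" "y' < a"
  shows "kept_share a x y' \<le> kept_share a x y"
proof -
  define t t' where "t = a - y" and "t' = a - y'"
  have t: "0 < t'" "t' \<le> t" using assms by (auto simp: t_def t'_def)
  have "t' * x * (t + x) \<le> t * x * (t' + x)"
    using mult_right_mono[OF t(2), of "x * x"] by (simp add: algebra_simps)
  then have "t' * x / (t' + x) \<le> t * x / (t + x)"
    using t assms by (intro frac_le_eq[THEN iffD2]) (auto simp: divide_simps)
  then show ?thesis
    unfolding kept_share_def t_def[symmetric] t'_def[symmetric]
    by (intro divide_right_mono add_mono t) simp_all
qed

text \<open>On \<open>[0, 1]\<close> the map \<open>y - y\<^sup>2 / 2\<close> has slopes in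
  \<open>[0, 1]\<close>; these are halved, and clipping at 0 enlarges no difference.\<close>

lemma best_price1_mono:
  assumes "0 \<le> y" "y \<le> y'" "y' \<le> 1"
  shows "best_price1 a r y \<le> best_price1 a r y'"
    and "best_price1 a r y' \<le> best_price1 a r y + (y' - y) / 2"
proof -
  have "0 \<le> (y' - y) * (1 - (y + y') / 2)" "0 \<le> (y' - y) * ((y + y') / 2)"
    using assms by auto
  then have "0 \<le> y' - y'\<^sup>2 / 2 - (y - y\<^sup>2 / 2)" "y' - y'\<^sup>2 / 2 - (y - y\<^sup>2 / 2) \<le> y' - y"
    by (simp_all add: field_simps power2_eq_square)
  then show "best_price1 a r y \<le> best_price1 a r y'"
    "best_price1 a r y' \<le> best_price1 a r y + (y' - y) / 2"
    unfolding best_price1_def using assms(2) by (auto simp: max_def field_simps)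
qed

text \<open>Firm 2's first-order condition after substituting firm 1's best response.\<close>

definition excess :: "real \<Rightarrow> real \<Rightarrow> real \<Rightarrow> real" where
  "excess a r y = y - (1 - a - r) - kept_share a (best_price1 a r y) y"

text \<open>Through firm 1's price, a rise in \<open>y\<close> lifts the share by at most 1/4 of
  that rise; its direct effect on the share is never positive. The term \<open>y\<close>
  prevails.\<close>

lemma excess_strict_mono:
  assumes "0 \<le> y" "y < y'" "y' < a" "a \<le> 1"
  shows "excess a r y < excess a r y'"
proof -
  have b: "best_price1 a r y \<le> best_price1 a r y'"
    "best_price1 a r y' \<le> best_price1 a r y + (y' - y) / 2" "0 \<le> best_price1 a r y"
    using best_price1_mono[of y y' a r] assms by (auto simp: best_price1_def)
  have "kept_share a (best_price1 a r y') y' \<le> kept_share a (best_price1 a r y) y' + (y' - y) / 4"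
    using kept_share_mono1(2)[OF b(3,1) assms(3)] b(2) by (simp add: field_simps)
  also have "\<dots> \<le> kept_share a (best_price1 a r y) y + (y' - y) / 4"
    using kept_share_antimono2[OF b(3), of y y' a] assms by simp
  finally show ?thesis using assms by (simp add: excess_def field_simps)
qed

text \<open>Cost enters directly with slope 1; by lowering firm 1's price it can only reduce the
  subtracted share.\<close>

lemma excess_strict_mono_cost:
  assumes "r < r'" "y < a"
  shows "excess a r y < excess a r' y"
proof -
  have "best_price1 a r' y \<le> best_price1 a r y" "0 \<le> best_price1 a r' y"
    using assms by (auto simp: best_price1_def max_def field_simps)
  then show ?thesis
    using kept_share_mono1(1)[of "best_price1 a r' y" "best_price1 a r y" y a] assms
    by (simp add: excess_def)
qed

section \<open>Existence and uniqueness of the equilibrium\<close>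

text \<open>As \<open>y - y\<^sup>2 / 2\<close> increases up to 1, the numerator is at most its
  value at \<open>y = a\<close>, which is \<open>1 - r\<close>.\<close>

lemma best_price1_le:
  assumes "y \<le> a" "y \<le> 1" "a \<le> 1" "r \<le> 1"
  shows "best_price1 a r y \<le> (1 - r) / 2"
proof -
  have "0 \<le> (a - y) * (1 - (a + y) / 2)" using assms by simp
  then have "y + (a\<^sup>2 - y\<^sup>2) / 2 \<le> a" by (simp add: field_simps power2_eq_square)
  then show ?thesis 
    unfolding best_price1_def using assms by (intro max.boundedI divide_right_mono) auto
qed

lemma ex_excess_zero:
  assumes "1/2 < a" "a < 1" "0 \<le> r" "r < 1 - a / 2"
  shows "\<exists>y. 0 \<le> y \<and> y \<le> (1 - r) / 2 \<and> excess a r y = 0"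
proof (rule IVT')
  have nonneg: "0 \<le> best_price1 a r y" for y by (simp add: best_price1_def)
  show "excess a r 0 \<le> 0"
  proof -
    have "a / 2 \<le> kept_share a (best_price1 a r 0) 0"
      using assms nonneg[of 0] by (simp add: kept_share_def)
    then show ?thesis using assms by (simp add: excess_def)
  qed
  show "0 \<le> excess a r ((1 - r) / 2)"
  proof -
    define q where "q = (1 - r) / 2"
    \<comment> \<open>Once the share is at most \<open>a - q\<close>, the excess is at least
      \<open>2 * q - (1 - r) = 0\<close>; hence the choice of the right endpoint.\<close>
    have "(a - q) * best_price1 a r q / (a - q + best_price1 a r q) \<le> a - q"
      using assms nonneg[of q] by (simp add: divide_simps q_def mult_left_mono)
    then have "kept_share a (best_price1 a r q) q \<le> a - q"
      by (simp add: kept_share_def)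
    then show ?thesis by (simp add: excess_def q_def[symmetric]) (simp add: q_def field_simps)
  qed
  show "continuous_on {0..(1 - r) / 2} (excess a r)"
  proof -
    have "a - y + max 0 ((1 - a - r + y + (a\<^sup>2 - y\<^sup>2) / 2) / 2) \<noteq> 0" if "y \<in> {0..(1 - r) / 2}" for y
      using that assms nonneg[of y] unfolding best_price1_def by auto
    then show ?thesis
      unfolding excess_def[abs_def] kept_share_def best_price1_def
      by (intro continuous_intros) auto
  qed
  show "0 \<le> (1 - r) / 2" using assms by simp
qed

text \<open>The price cap keeps the second price of any other candidate below \<open>a\<close>, so
  \<open>equilibrium_iff\<close> makes it a zero of the strictly increasing
  \<open>excess\<close>.\<close>

lemma equilibrium_prices_eq:
  assumes "1/2 < a" "a < 1" "0 \<le> r" "r < 1 - a / 2"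
    and y: "0 \<le> y" "y \<le> (1 - r) / 2" "excess a r y = 0"
  shows "equilibrium_prices a r = (best_price1 a r y, y)"
  unfolding equilibrium_prices_def
proof (rule the_equality)
  have b: "0 \<le> best_price1 a r y" "best_price1 a r y \<le> (1 - r) / 2"
    using best_price1_le[of y a r] assms by (auto simp: best_price1_def)
  then have "equilibrium a r (best_price1 a r y) y"
    using equilibrium_iff[of "best_price1 a r y" y a r] assms by (simp add: excess_def)
  then show "case (best_price1 a r y, y) of (p1, p2) \<Rightarrow>
      equilibrium a r p1 p2 \<and> p1 \<in> {0..(1 - r) / 2} \<and> p2 \<in> {0..(1 - r) / 2}"
    using b y by simp
next
  fix z :: "real \<times> real"
  assume z: "case z of (p1, p2) \<Rightarrow>
      equilibrium a r p1 p2 \<and> p1 \<in> {0..(1 - r) / 2} \<and> p2 \<in> {0..(1 - r) / 2}"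
  obtain x' y' where z_eq: "z = (x', y')" by (cases z)
  with z have *: "equilibrium a r x' y'" "0 \<le> x'" "0 \<le> y'" "y' \<le> (1 - r) / 2" by auto
  then have x': "x' = best_price1 a r y'" and "excess a r y' = 0"
    using equilibrium_iff[of x' y' a r] assms by (auto simp: excess_def)
  then have "y' = y"
    using excess_strict_mono[of y y' a r] excess_strict_mono[of y' y a r] * assms
    by (cases y y' rule: linorder_cases) auto
  with x' z_eq show "z = (best_price1 a r y, y)" by simp
qed

section \<open>Ranking of the prices and monotonicity of the surplus\<close>

text \<open>Were firm 1's price higher, it would be interior and both first-order conditions would
  be equations; their difference then has the wrong sign.\<close>

lemma best_price1_le_price2:
  assumes "0 \<le> y" "y < a" "a < 1" "excess a r y = 0"
  shows "best_price1 a r y \<le> y"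
proof (rule ccontr)
  define x where "x = best_price1 a r y"
  define d where "d = x - y"
  define t where "t = a - y"
  assume "\<not> ?thesis"
  then have d: "d > 0" by (simp add: x_def d_def)
  then have "0 < x" using assms by (simp add: d_def)
  then have x: "2 * x = 1 - a - r + y + (a\<^sup>2 - y\<^sup>2) / 2"
    by (auto simp: x_def best_price1_def max_def split: if_splits)
  have y: "y = 1 - a - r + kept_share a x y"
    using assms by (simp add: excess_def x_def)
  have t: "0 < t" "t + x > 0" using assms \<open>0 < x\<close> by (auto simp: t_def)
  have "2 * d = (a\<^sup>2 - y\<^sup>2) / 2 - kept_share a x y" using x y by (simp add: d_def)
  then have "(t + x) * (2 * d) = (t + x) * ((a\<^sup>2 - y\<^sup>2) / 2) - (t + x) * kept_share a x y"
    by (simp add: right_diff_distrib)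
  also have "(t + x) * kept_share a x y = t / 2 * (t + 2 * x)"
    using t unfolding kept_share_def t_def[symmetric] by (simp add: field_simps)
  \<comment> \<open>Uses \<open>t + x = a + d\<close> and
    \<open>t + 2 * x = a + y + 2 * d\<close>.\<close>
  also have "(t + x) * ((a\<^sup>2 - y\<^sup>2) / 2) - t / 2 * (t + 2 * x)
      = - (t / 2) * ((1 - a) * (a + y) + d * (2 - (a + y)))"
    by (simp add: t_def d_def field_simps power2_eq_square)
  also have "\<dots> < 0"
  proof -
    have "0 < (1 - a) * (a + y) + d * (2 - (a + y))"
      using assms d by (intro add_nonneg_pos mult_nonneg_nonneg mult_pos_pos) auto
    then show ?thesis using t by (simp add: mult_pos_pos)
  qed
  finally show False using t d by (simp add: mult_less_0_iff)
qed

lemma rbar_less: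
  assumes "0 < a" "a < 1"
  shows "rbar a < 1 - a / 2"
proof -
  have "sqrt (4 * a\<^sup>2 - 4 * a + 9) < 3"
    by (rule real_less_lsqrt) (use assms in \<open>auto simp: power2_eq_square\<close>)
  then show ?thesis by (simp add: rbar_def)
qed

text \<open>The prices move one at a time, first \<open>x\<close>, then \<open>y\<close>, and each
  difference is factored exactly.\<close>

lemma surplus_polynomial_strict_antimono:
  fixes a x x' y y' :: real
  defines "C \<equiv> \<lambda>x y. (1 - x)\<^sup>2 / 2 + x * (1 - y)\<^sup>2 / 2 + ((1 - y) ^ 3 - (1 - a) ^ 3) / 6
      - (1 - a)\<^sup>2 / 2 * (a + x - y)"
  assumes "1/2 < a" "a < 1" "0 \<le> x'" "x' \<le> x" "x \<le> 1/2" "0 \<le> y'" "y' < y" "y \<le> 1/2"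
  shows "C x y < C x' y'"
proof -
  have "0 \<le> (x - x') * ((2 - x - x') - (1 - y)\<^sup>2 + (1 - a)\<^sup>2) / 2"
  proof -
    have "(1 - y)\<^sup>2 \<le> 1" using assms by (intro power_le_one) auto
    then show ?thesis using assms zero_le_power2[of "1 - a"] by (intro divide_nonneg_pos mult_nonneg_nonneg) linarith+
  qed
  also have "\<dots> = C x' y - C x y"
    by (simp add: C_def algebra_simps power2_eq_square add_divide_distrib diff_divide_distrib)
  finally have "C x y \<le> C x' y" by simp
  also have "\<dots> < C x' y'"
  proof -
    \<comment> \<open>As \<open>y < a\<close>, both \<open>w\<close> and \<open>w'\<close> exceed
      \<open>b\<close>, so the gain outweighs the added search cost
      \<open>b\<^sup>2 / 2 * (w' - w)\<close>. Strictness comes from here.\<close>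
    define w w' b where "w = 1 - y" and "w' = 1 - y'" and "b = 1 - a"
    have w: "b < w" "w < w'" "0 < b" using assms by (auto simp: w_def w'_def b_def)
    have "b * b < w * w" "b * b < w * w'" "b * b < w' * w'"
      using w by (auto intro!: mult_strict_mono)
    moreover have "0 \<le> x' * (w + w')" using w assms by simp
    ultimately have "0 < (w' - w) * (x' * (w + w') / 2 + (w' * w' + w * w' + w * w) / 6 - b * b / 2)"
      using w by (intro mult_pos_pos) (simp_all add: field_simps)
    also have "\<dots> = x' * w'\<^sup>2 / 2 - x' * w\<^sup>2 / 2 + (w' ^ 3 - w ^ 3) / 6 - b\<^sup>2 / 2 * (w' - w)"
      by (simp add: field_simps power2_eq_square power3_eq_cube)
    also have "\<dots> = C x' y' - C x' y"
      unfolding C_def w_def[symmetric] w'_def[symmetric] b_def[symmetric]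
      by (simp add: w_def w'_def algebra_simps diff_divide_distrib)
    finally show ?thesis by simp
  qed
  finally show ?thesis .
qed

theorem corollary2:
  fixes s a :: real
  assumes "0 < s" and "s < 1/8"
    and "a = search_threshold s"
  shows "strict_mono_on {0..rbar a}
           (\<lambda>r. case equilibrium_prices a r of (p1, p2) \<Rightarrow> consumer_surplus s p1 p2)"
proof (rule strict_mono_onI)
  fix r r' assume r: "r \<in> {0..rbar a}" "r' \<in> {0..rbar a}" "r < r'"
  have "sqrt (2 * s) < 1 / 2"
    by (rule real_less_lsqrt) (use assms in \<open>auto simp: power2_eq_square\<close>)
  then have a: "1/2 < a" "a < 1"
    using assms by (auto simp: search_threshold_def)
  have r_less: "r < 1 - a / 2" "r' < 1 - a / 2" "0 \<le> r" "0 \<le> r'"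
    using rbar_less[of a] a r by auto
  obtain y where y: "0 \<le> y" "y \<le> (1 - r) / 2" "excess a r y = 0"
    using ex_excess_zero[of a r] a r_less by auto
  obtain y' where y': "0 \<le> y'" "y' \<le> (1 - r') / 2" "excess a r' y' = 0"
    using ex_excess_zero[of a r'] a r_less by auto
  define x x' where "x = best_price1 a r y" and "x' = best_price1 a r' y'"
  have half: "y \<le> 1/2" "y' \<le> 1/2" using y y' r_less by (simp_all add: field_simps)
  \<comment> \<open>Otherwise
    \<open>0 = excess a r y < excess a r' y \<le> excess a r' y' = 0\<close>.\<close>
  have "y' < y"
  proof (rule ccontr)
    assume "\<not> ?thesis"
    then have "excess a r' y \<le> excess a r' y'"
      using excess_strict_mono[of y y' a r'] y(1) half a by (cases "y = y'") auto
    then show False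
      using excess_strict_mono_cost[of r r' y a] r(3) y(3) y'(3) half a by auto
  qed
  have "x' \<le> best_price1 a r y'"
    unfolding x'_def best_price1_def using r(3) by (intro max.mono divide_right_mono) auto
  also have "\<dots> \<le> x"
    unfolding x_def using \<open>y' < y\<close> y'(1) half by (intro best_price1_mono) auto
  finally have "x' \<le> x" .
  have x_le: "x \<le> y" "x' \<le> y'"
    using best_price1_le_price2 y y' half a by (auto simp: x_def x'_def)
  have x0: "0 \<le> x" "0 \<le> x'" by (simp_all add: x_def x'_def best_price1_def)
  \<comment> \<open>The bounds in \<open>x_le\<close> keep both cut-offs at most \<open>a\<close>,
    hence below 1, so the closed form applies to both pairs.\<close>
  have "consumer_surplus s x y < consumer_surplus s x' y'"
    using surplus_polynomial_strict_antimono[of a x' x y' y] \<open>x' \<le> x\<close> \<open>y' < y\<close> x_le x0 y y' half a assms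
    by (simp add: consumer_surplus_eq)
  then show "(case equilibrium_prices a r of (p1, p2) \<Rightarrow> consumer_surplus s p1 p2)
      < (case equilibrium_prices a r' of (p1, p2) \<Rightarrow> consumer_surplus s p1 p2)"
    using equilibrium_prices_eq[OF a r_less(3,1) y] equilibrium_prices_eq[OF a r_less(4,2) y']
    by (simp add: x_def x'_def)
qed

end
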